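(* Let $X$ be a finite-dimensional vector space over $K=\mathbb{F}_2$ equipped with a (possibly degenerate) alternating bilinear form $\omega$, and let $S$ be a basis of $X$ of orthogonal type. Then two nonzero elements $\alpha$ and $\beta$ of $X^\ast$ belong to the same orbit of $\Gamma_S^\ast$ if and only if there is an $x\in X$ such that $\omega(x)=\alpha+\beta$ and $Q_S(x)=\alpha(x)$.
   Context: The form $\omega$ also denotes the linear map $\omega:X\to X^\ast$, $\omega(x)(y)=\omega(x,y)$. For $s\in X$ let $T_s:X\to X$, $T_s(x)=x+\omega(x,s)s$. $\Gamma_S$ is the subgroup of $\mathrm{GL}(X)$ generated by all $T_s$, $s\in S$. For $g\in\mathrm{GL}(X)$, $g^\ast(\alpha)=\alpha\circ g$ for $\alpha\in X^\ast$, and $\Gamma_S^\ast=\{g^\ast:g\in\Gamma_S\}$, acting on $X^\ast$. $G(S)$ is the graph with vertex set $S$ and an edge between $u$ and $v$ if $\omega(u,v)=1$. Given a basis $S$ of $X$ and $s,t\in S$ with $\omega(s,t)=1$, replacing $t$ by $s+t$ gives another basis; two bases are t-equivalent if one is obtained from the other by a sequence of such replacements. A basis $S$ is of orthogonal type if it is t-equivalent to a basis $S'$ such that $G(S')$ is a tree containing $E_6$ as an induced subgraph, where $E_6$ is the graph with vertices $v_1,\dots,v_6$ and edges $v_1v_2,v_2v_3,v_3v_4,v_4v_5,v_3v_6$. $Q_S$ is the unique quadratic form on $X$ with $Q_S(s)=1$ for all $s\in S$ and $Q_S(x+y)+Q_S(x)+Q_S(y)=\omega(x,y)$ for all $x,y\in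 X$. *)

theory Defs
  imports Complex_Main "HOL-Library.Z2" "HOL-Algebra.Generated_Groups" "HOL-Algebra.Group_Action"
begin

text \<open>
  The space \<open>X\<close> is the carrier of the type \<open>'a\<close>, with scalar multiplication
  \<open>scale :: bit \<Rightarrow> 'a \<Rightarrow> 'a\<close>; the field with two elements is \<^typ>\<open>bit\<close>.
\<close>

definition is_basis :: "(bit \<Rightarrow> 'a::ab_group_add \<Rightarrow> 'a) \<Rightarrow> 'a set \<Rightarrow> bool" where
  "is_basis scale S \<longleftrightarrow> \<not> Modules.module.dependent scale S \<and> Modules.module.span scale S = UNIV"

definition bilinear_form :: "(bit \<Rightarrow> 'a::ab_group_add \<Rightarrow> 'a) \<Rightarrow> ('a \<Rightarrow> 'a \<Rightarrow> bit) \<Rightarrow> bool" where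
  "bilinear_form scale \<omega> \<longleftrightarrow>
     (\<forall>x. Vector_Spaces.linear scale (*) (\<lambda>y. \<omega> x y)) \<and>
     (\<forall>y. Vector_Spaces.linear scale (*) (\<lambda>x. \<omega> x y))"

definition alternating_form :: "(bit \<Rightarrow> 'a::ab_group_add \<Rightarrow> 'a) \<Rightarrow> ('a \<Rightarrow> 'a \<Rightarrow> bit) \<Rightarrow> bool" where
  "alternating_form scale \<omega> \<longleftrightarrow> bilinear_form scale \<omega> \<and> (\<forall>x. \<omega> x x = 0)"

definition dual_space :: "(bit \<Rightarrow> 'a::ab_group_add \<Rightarrow> 'a) \<Rightarrow> ('a \<Rightarrow> bit) set" where
  "dual_space scale = {\<alpha>. Vector_Spaces.linear scale (*) \<alpha>}"


subsection \<open>Transvections and the groups they generate\<close>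

definition GL :: "(bit \<Rightarrow> 'a::ab_group_add \<Rightarrow> 'a) \<Rightarrow> ('a \<Rightarrow> 'a) monoid" where
  "GL scale = \<lparr>carrier = {g. Vector_Spaces.linear scale scale g \<and> bij g},
               mult = (\<circ>), one = id\<rparr>"

definition transvection ::
    "(bit \<Rightarrow> 'a::ab_group_add \<Rightarrow> 'a) \<Rightarrow> ('a \<Rightarrow> 'a \<Rightarrow> bit) \<Rightarrow> 'a \<Rightarrow> 'a \<Rightarrow> 'a" where
  "transvection scale \<omega> s x = x + scale (\<omega> x s) s"

definition Gamma ::
    "(bit \<Rightarrow> 'a::ab_group_add \<Rightarrow> 'a) \<Rightarrow> ('a \<Rightarrow> 'a \<Rightarrow> bit) \<Rightarrow> 'a set \<Rightarrow> ('a \<Rightarrow> 'a) set" where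
  "Gamma scale \<omega> S = generate (GL scale) (transvection scale \<omega> ` S)"

text \<open>
  The map \<open>g\<^sup>*\<close> is a permutation of the dual space; following the convention of
  \<^const>\<open>BijGroup\<close> it is \<^const>\<open>undefined\<close> off the dual space.
\<close>

definition dual_map ::
    "(bit \<Rightarrow> 'a::ab_group_add \<Rightarrow> 'a) \<Rightarrow> ('a \<Rightarrow> 'a) \<Rightarrow> ('a \<Rightarrow> bit) \<Rightarrow> ('a \<Rightarrow> bit)" where
  "dual_map scale g = (\<lambda>\<alpha>\<in>dual_space scale. \<alpha> \<circ> g)"

definition Gamma_dual ::
    "(bit \<Rightarrow> 'a::ab_group_add \<Rightarrow> 'a) \<Rightarrow> ('a \<Rightarrow> 'a \<Rightarrow> bit) \<Rightarrow> 'a set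
      \<Rightarrow> (('a \<Rightarrow> bit) \<Rightarrow> ('a \<Rightarrow> bit)) monoid" where
  "Gamma_dual scale \<omega> S =
     BijGroup (dual_space scale) \<lparr>carrier := dual_map scale ` Gamma scale \<omega> S\<rparr>"


subsection \<open>Graphs\<close>

text \<open>
  A simple graph is given by a vertex set \<open>V\<close> and an adjacency relation \<open>E\<close>, of which only
  the restriction to \<open>V\<close> matters; \<open>E\<close> is symmetric and irreflexive on \<open>V\<close> in all uses.
\<close>

definition connected_graph :: "'v set \<Rightarrow> ('v \<Rightarrow> 'v \<Rightarrow> bool) \<Rightarrow> bool" where
  "connected_graph V E \<longleftrightarrow>
     V \<noteq> {} \<and> (\<forall>u\<in>V. \<forall>v\<in>V. (\<lambda>x y. x \<in> V \<and> y \<in> V \<and> E x y)\<^sup>*\<^sup>* u v)"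

definition is_cycle :: "'v set \<Rightarrow> ('v \<Rightarrow> 'v \<Rightarrow> bool) \<Rightarrow> 'v list \<Rightarrow> bool" where
  "is_cycle V E c \<longleftrightarrow>
     3 \<le> length c \<and> distinct c \<and> set c \<subseteq> V \<and> successively E c \<and> E (last c) (hd c)"

definition is_tree :: "'v set \<Rightarrow> ('v \<Rightarrow> 'v \<Rightarrow> bool) \<Rightarrow> bool" where
  "is_tree V E \<longleftrightarrow> connected_graph V E \<and> (\<nexists>c. is_cycle V E c)"

definition contains_induced ::
    "'v set \<Rightarrow> ('v \<Rightarrow> 'v \<Rightarrow> bool) \<Rightarrow> 'w set \<Rightarrow> ('w \<Rightarrow> 'w \<Rightarrow> bool) \<Rightarrow> bool" where
  "contains_induced V E W F \<longleftrightarrow>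
     (\<exists>f. inj_on f W \<and> f ` W \<subseteq> V \<and> (\<forall>i\<in>W. \<forall>j\<in>W. E (f i) (f j) \<longleftrightarrow> F i j))"

definition E6_verts :: "nat set" where
  "E6_verts = {1..6}"

definition E6_adj :: "nat \<Rightarrow> nat \<Rightarrow> bool" where
  "E6_adj i j \<longleftrightarrow> {i, j} \<in> {{1, 2}, {2, 3}, {3, 4}, {4, 5}, {3, 6}}"

text \<open>The graph \<open>G(S)\<close> has vertex set \<open>S\<close> and the following adjacency relation.\<close>

definition form_adj :: "('a \<Rightarrow> 'a \<Rightarrow> bit) \<Rightarrow> 'a \<Rightarrow> 'a \<Rightarrow> bool" where
  "form_adj \<omega> u v \<longleftrightarrow> \<omega> u v = 1"


subsection \<open>Bases of orthogonal type\<close>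

definition t_step :: "('a::ab_group_add \<Rightarrow> 'a \<Rightarrow> bit) \<Rightarrow> 'a set \<Rightarrow> 'a set \<Rightarrow> bool" where
  "t_step \<omega> S S' \<longleftrightarrow> (\<exists>s\<in>S. \<exists>t\<in>S. \<omega> s t = 1 \<and> S' = insert (s + t) (S - {t}))"

definition t_equivalent :: "('a::ab_group_add \<Rightarrow> 'a \<Rightarrow> bit) \<Rightarrow> 'a set \<Rightarrow> 'a set \<Rightarrow> bool" where
  "t_equivalent \<omega> S S' \<longleftrightarrow> (t_step \<omega>)\<^sup>*\<^sup>* S S' \<or> (t_step \<omega>)\<^sup>*\<^sup>* S' S"

definition orthogonal_type ::
    "(bit \<Rightarrow> 'a::ab_group_add \<Rightarrow> 'a) \<Rightarrow> ('a \<Rightarrow> 'a \<Rightarrow> bit) \<Rightarrow> 'a set \<Rightarrow> bool" where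
  "orthogonal_type scale \<omega> S \<longleftrightarrow> is_basis scale S \<and>
     (\<exists>S'. is_basis scale S' \<and> t_equivalent \<omega> S S' \<and>
           is_tree S' (form_adj \<omega>) \<and>
           contains_induced S' (form_adj \<omega>) E6_verts E6_adj)"


subsection \<open>The quadratic form of a basis\<close>

definition quadratic_form :: "(bit \<Rightarrow> 'a::ab_group_add \<Rightarrow> 'a) \<Rightarrow> ('a \<Rightarrow> bit) \<Rightarrow> bool" where
  "quadratic_form scale Q \<longleftrightarrow>
     (\<forall>a x. Q (scale a x) = a\<^sup>2 * Q x) \<and> bilinear_form scale (\<lambda>x y. Q (x + y) - Q x - Q y)"

definition basis_form ::
    "(bit \<Rightarrow> 'a::ab_group_add \<Rightarrow> 'a) \<Rightarrow> ('a \<Rightarrow> 'a \<Rightarrow> bit) \<Rightarrow> 'a set \<Rightarrow> 'a \<Rightarrow> bit" where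
  "basis_form scale \<omega> S =
     (THE Q. quadratic_form scale Q \<and> (\<forall>s\<in>S. Q s = 1) \<and>
             (\<forall>x y. Q (x + y) + Q x + Q y = \<omega> x y))"


subsection \<open>Well-definedness\<close>

text \<open>Keep \<open>+\<close> and \<open>*\<close> on \<^typ>\<open>bit\<close> as ring operations.\<close>

declare add_bit_eq_xor [simp del] mult_bit_eq_and [simp del]

lemma vs_linearI:
  assumes "vector_space s1" "vector_space s2"
    and "\<And>x y. f (x + y) = f x + f y" and "\<And>a x. f (s1 a x) = s2 a (f x)"
  shows "Vector_Spaces.linear s1 s2 f"
  using assms by (simp add: Vector_Spaces.linear_iff)

lemma group_GL:
  assumes "vector_space scale"
  shows "group (GL scale)"
proof (rule groupI)
  interpret vector_space scale by fact
  interpret P: vector_space_pair scale scale by unfold_locales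
  show "x \<otimes>\<^bsub>GL scale\<^esub> y \<in> carrier (GL scale)"
    if "x \<in> carrier (GL scale)" "y \<in> carrier (GL scale)" for x y
    using that by (auto simp: GL_def bij_comp intro: Vector_Spaces.linear_compose)
  show "\<one>\<^bsub>GL scale\<^esub> \<in> carrier (GL scale)"
    by (auto simp: GL_def linear_id)
  show "x \<otimes>\<^bsub>GL scale\<^esub> y \<otimes>\<^bsub>GL scale\<^esub> z = x \<otimes>\<^bsub>GL scale\<^esub> (y \<otimes>\<^bsub>GL scale\<^esub> z)" for x y z
    by (auto simp: GL_def)
  show "\<one>\<^bsub>GL scale\<^esub> \<otimes>\<^bsub>GL scale\<^esub> x = x" for x
    by (auto simp: GL_def)
  show "\<exists>y\<in>carrier (GL scale). y \<otimes>\<^bsub>GL scale\<^esub> x = \<one>\<^bsub>GL scale\<^esub>"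
    if "x \<in> carrier (GL scale)" for x
  proof -
    from that have x: "Vector_Spaces.linear scale scale x" "bij x" by (auto simp: GL_def)
    have "Vector_Spaces.linear scale scale (inv_into UNIV x)"
    proof (rule vs_linearI[OF assms(1) assms(1)])
      fix b1 b2 r
      interpret L: Vector_Spaces.linear scale scale x by fact
      show "inv_into UNIV x (b1 + b2) = inv_into UNIV x b1 + inv_into UNIV x b2"
        by (metis L.add x(2) bij_inv_eq_iff)
      show "inv_into UNIV x (scale r b1) = scale r (inv_into UNIV x b1)"
        by (metis L.scale x(2) bij_inv_eq_iff)
    qed
    moreover have "bij (inv_into UNIV x)" using x(2) by (rule bij_imp_bij_inv)
    moreover have "inv_into UNIV x \<circ> x = id" using x(2) by (simp add: bij_is_inj)
    ultimately show ?thesis by (auto simp: GL_def)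
  qed
qed

lemma transvection_in_GL:
  assumes "vector_space scale" and "alternating_form scale \<omega>"
  shows "transvection scale \<omega> s \<in> carrier (GL scale)"
proof -
  interpret vector_space scale by fact
  interpret P: vector_space_pair scale scale by unfold_locales
  have lin: "Vector_Spaces.linear scale (*) (\<lambda>x. \<omega> x s)" and alt: "\<omega> s s = 0"
    using assms(2) by (auto simp: alternating_form_def bilinear_form_def)
  interpret L: Vector_Spaces.linear scale "(*)" "\<lambda>x. \<omega> x s" by (fact lin)
  have dbl: "y + y = 0" for y :: 'a
    using scale_left_distrib[of 1 1 y] by simp
  have "transvection scale \<omega> s (transvection scale \<omega> s x) = x" for x
    by (simp add: transvection_def L.add L.scale alt add.assoc dbl)
  then have "bij (transvection scale \<omega> s)" by (intro o_bij[where g = "transvection scale \<omega> s"] ext) simp_all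
  moreover have "Vector_Spaces.linear scale scale (transvection scale \<omega> s)"
    by (rule vs_linearI[OF assms(1) assms(1)])
      (simp_all add: transvection_def L.add L.scale scale_left_distrib scale_right_distrib add_ac)
  ultimately show ?thesis by (simp add: GL_def)
qed

lemma basis_form_unique_existence:
  assumes "vector_space scale" and "alternating_form scale \<omega>"
    and "is_basis scale S" and "finite S"
  shows "\<exists>!Q. quadratic_form scale Q \<and> (\<forall>s\<in>S. Q s = 1) \<and>
              (\<forall>x y. Q (x + y) + Q x + Q y = \<omega> x y)"
proof -
  interpret vector_space scale by fact
  have indep: "independent S" and span: "span S = UNIV"
    using assms(3) by (auto simp: is_basis_def)
  have bil: "bilinear_form scale \<omega>" and alt: "\<omega> x x = 0" for x
    using assms(2) by (auto simp: alternating_form_def)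
  interpret L: Vector_Spaces.linear scale "(*)" "\<lambda>y. \<omega> x y" for x
    using bil by (simp add: bilinear_form_def)
  interpret R: Vector_Spaces.linear scale "(*)" "\<lambda>x. \<omega> x y" for y
    using bil by (simp add: bilinear_form_def)
  have b2: "a + a = 0" for a :: bit by (cases a) auto
  have sym: "\<omega> x y = \<omega> y x" for x y
  proof -
    have "\<omega> (x + y) (x + y) = \<omega> x x + \<omega> y x + (\<omega> x y + \<omega> y y)"
      by (simp only: L.add R.add add_ac)
    then have "\<omega> y x + \<omega> x y = 0"
      by (simp only: alt add_0_left add_0_right)
    then show ?thesis using add_right_cancel[of "\<omega> x y" "\<omega> x y" "\<omega> y x"] by (simp only: b2 simp_thms)
  qed
  define r where "r = representation S"
  have r_add: "r (x + y) s = r x s + r y s" for x y s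
    unfolding r_def using representation_add[OF indep] span by simp
  have r_scale: "r (scale a x) s = a * r x s" for a x s
    unfolding r_def using representation_scale[OF indep] span by simp
  have r_sum: "(\<Sum>s\<in>S. scale (r x s) s) = x" for x
    unfolding r_def using sum_representation_eq[OF indep _ \<open>finite S\<close>] span by blast
  have r_basis: "r s t = (if t = s then 1 else 0)" if "s \<in> S" for s t
    unfolding r_def using representation_basis[OF indep that] by auto
  obtain f :: "'a \<Rightarrow> nat" where f: "inj_on f S"
    using \<open>finite S\<close> finite_imp_inj_to_nat_seg by meson
  define c where "c = (\<lambda>s t. if s = t then 1 else if f s < f t then \<omega> s t else 0)"
  have c: "c s t + c t s = \<omega> s t" if "s \<in> S" "t \<in> S" for s t
    using that f sym[of s t] by (auto simp: c_def alt b2 dest: inj_onD)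
  define B where "B = (\<lambda>x y. \<Sum>s\<in>S. \<Sum>t\<in>S. c s t * (r x s * r y t))"
  have \<omega>: "\<omega> x y = (\<Sum>s\<in>S. \<Sum>t\<in>S. \<omega> s t * (r x s * r y t))" for x y
  proof -
    have "\<omega> x y = \<omega> (\<Sum>s\<in>S. scale (r x s) s) (\<Sum>t\<in>S. scale (r y t) t)"
      by (simp add: r_sum)
    also have "\<dots> = (\<Sum>s\<in>S. \<Sum>t\<in>S. \<omega> s t * (r x s * r y t))"
    proof -
      have "\<omega> u (\<Sum>t\<in>S. scale (r y t) t) = (\<Sum>t\<in>S. r y t * \<omega> u t)" for u
        by (simp add: L.sum L.scale)
      then have "\<omega> (\<Sum>s\<in>S. scale (r x s) s) (\<Sum>t\<in>S. scale (r y t) t) =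
          (\<Sum>t\<in>S. r y t * \<omega> (\<Sum>s\<in>S. scale (r x s) s) t)" by blast
      also have "\<dots> = (\<Sum>t\<in>S. r y t * (\<Sum>s\<in>S. r x s * \<omega> s t))"
        by (simp add: R.sum R.scale)
      also have "\<dots> = (\<Sum>t\<in>S. \<Sum>s\<in>S. \<omega> s t * (r x s * r y t))"
        by (intro sum.cong refl, subst sum_distrib_left) (simp only: mult_ac)
      also have "\<dots> = (\<Sum>s\<in>S. \<Sum>t\<in>S. \<omega> s t * (r x s * r y t))"
        by (rule sum.swap)
      finally show ?thesis .
    qed
    finally show ?thesis .
  qed
  have polar: "B (x + y) (x + y) + B x x + B y y = \<omega> x y" for x y
  proof -
    have "B (x + y) (x + y) = B x x + B x y + B y x + B y y"
      unfolding B_def r_add distrib_left distrib_right sum.distrib by (simp only: add_ac)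
    moreover have "p + q + r + s + p + s = q + r" for p q r s :: bit
      by (cases p; cases q; cases r; cases s) simp_all
    ultimately have "B (x + y) (x + y) + B x x + B y y = B x y + B y x"
      by (simp only:)
    also have "B y x = (\<Sum>s\<in>S. \<Sum>t\<in>S. c t s * (r x s * r y t))"
      unfolding B_def
      by (rule trans[OF sum.swap]) (intro sum.cong refl arg_cong2[where f = "(*)"] mult.commute)
    also have "B x y + \<dots> = (\<Sum>s\<in>S. \<Sum>t\<in>S. (c s t + c t s) * (r x s * r y t))"
      by (simp only: B_def sum.distrib distrib_right)
    also have "\<dots> = \<omega> x y" unfolding \<omega>[of x y] by (intro sum.cong refl) (simp add: c)
    finally show ?thesis .
  qed
  show ?thesis
  proof (rule ex_ex1I, rule exI[where x = "\<lambda>x. B x x"], intro conjI ballI allI)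
    have "(\<lambda>x y. B (x + y) (x + y) - B x x - B y y) = \<omega>"
      by (simp add: polar)
    moreover have "B (scale a x) (scale a x) = a\<^sup>2 * B x x" for a x
      unfolding B_def r_scale power2_eq_square sum_distrib_left
      by (intro sum.cong refl) (simp only: mult_ac)
    ultimately show "quadratic_form scale (\<lambda>x. B x x)"
      using bil by (simp add: quadratic_form_def)
  next
    fix s assume s: "s \<in> S"
    have "B s s = (\<Sum>u\<in>S. \<Sum>t\<in>S. if t = s then (if u = s then 1 else 0) else 0)"
      unfolding B_def by (intro sum.cong refl) (auto simp: r_basis[OF s] c_def)
    then show "B s s = 1" using s \<open>finite S\<close> by simp
  next
    show "B (x + y) (x + y) + B x x + B y y = \<omega> x y" for x y by (rule polar)
  next
    fix Q Q'
    assume Q: "quadratic_form scale Q \<and> (\<forall>s\<in>S. Q s = 1) \<and> (\<forall>x y. Q (x + y) + Q x + Q y = \<omega> x y)"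
    assume Q': "quadratic_form scale Q' \<and> (\<forall>s\<in>S. Q' s = 1) \<and> (\<forall>x y. Q' (x + y) + Q' x + Q' y = \<omega> x y)"
    have add: "P (x + y) = \<omega> x y + P x + P y" if "\<forall>x y. P (x + y) + P x + P y = \<omega> x y" for P x y
      using that[rule_format, of x y, symmetric] b2[of "P x"] b2[of "P y"] by (simp add: add_ac b2)
    have zero: "P 0 = 0" if "quadratic_form scale P" for P
      using that scale_zero_left[of 0] by (metis mult_zero_left power_zero_numeral quadratic_form_def)
    have "Q x = Q' x" if "x \<in> span S" for x
      using that
    proof (induction rule: span_induct_alt)
      case base
      show ?case using zero[OF conjunct1[OF Q]] zero[OF conjunct1[OF Q']] by simp
    next
      case (step a s y)
      have "P (scale a s + y) = \<omega> (scale a s) y + a\<^sup>2 * 1 + P y"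
        if "quadratic_form scale P \<and> (\<forall>s\<in>S. P s = 1) \<and> (\<forall>x y. P (x + y) + P x + P y = \<omega> x y)" for P
        using that step.hyps add[of P "scale a s" y] by (simp add: quadratic_form_def)
      from this[OF Q] this[OF Q'] step.IH show ?case by simp
    qed
    then show "Q = Q'" using span by auto
  qed
qed

end

theory Submission
  imports Defs
begin

text \<open>
  Along an orbit of \<open>\<Gamma>\<^sub>S\<^sup>*\<close> the functional changes by \<open>\<omega>(x)\<close> with \<open>Q(x) = \<alpha>(x)\<close>, and this relation is
  transitive. For the converse only connectedness of \<open>G(S')\<close> and the induced \<open>E\<^sub>6\<close> matter. On \<open>E\<^sub>6\<close>
  the form is nondegenerate and every nonzero functional can be moved to one of two representatives,
  which the quadratic form separates. The vertices of \<open>G(S')\<close> are then added one at a time: given a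
  functional that is nonzero on the old vertices, the induction hypothesis moves it so that it takes
  the value 1 at the new vertex \<open>v\<close>, and \<open>T\<^sub>v\<close> changes the coset of the witness \<open>x\<close> modulo the old
  span. The freedom needed for this move comes from the quadric of \<open>E\<^sub>6\<close>, which meets every affine
  hyperplane in enough points.
\<close>

section \<open>Vector spaces over the field with two elements\<close>

lemma bit_add_self [simp]: "a + a = 0" for a :: bit
  by (cases a) auto

lemma bit_add_left_self [simp]: "a + (a + b) = b" for a b :: bit
  by (simp add: add.assoc [symmetric])

lemma bit_add_eq_1_iff: "a + b = 1 \<longleftrightarrow> a \<noteq> b" for a b :: bit
  by (cases a; cases b) auto

locale f2_quadratic_space = vector_space scale
  for scale :: "bit \<Rightarrow> 'a::ab_group_add \<Rightarrow> 'a" +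
  fixes \<omega> :: "'a \<Rightarrow> 'a \<Rightarrow> bit" and Q :: "'a \<Rightarrow> bit"
  assumes form_add_left: "\<omega> (x + y) z = \<omega> x z + \<omega> y z"
    and form_self: "\<omega> x x = 0"
    and form_commute: "\<omega> x y = \<omega> y x"
    and Q_add: "Q (x + y) = Q x + Q y + \<omega> x y"
begin

lemma form_add_right: "\<omega> z (x + y) = \<omega> z x + \<omega> z y"
  by (simp add: form_commute[of z] form_add_left)

lemma double [simp]: "x + x = 0" for x :: 'a
  using scale_left_distrib[of 1 1 x] by simp

lemma double_left [simp]: "x + (x + y) = y" for x y :: 'a
  by (simp add: add.assoc [symmetric])

lemma eq_iff_add_eq_0: "x = y \<longleftrightarrow> x + y = 0" for x y :: 'a
  using add_left_cancel[of x y x] by (auto simp del: add_left_cancel)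

lemma diff_eq_add [simp]: "x - y = x + y" for x y :: 'a
  using diff_eq_eq[of x y "x + y"] by (simp add: add.assoc)

lemma form_0_left [simp]: "\<omega> 0 y = 0"
  using form_add_left[of 0 0 y] by simp

lemma form_0_right [simp]: "\<omega> y 0 = 0"
  using form_commute[of y 0] by simp

lemma Q_0 [simp]: "Q 0 = 0"
  using Q_add[of 0 0] by simp

lemma form_scale_left [simp]: "\<omega> (scale a x) y = a * \<omega> x y"
  by (cases a) auto

lemma form_scale_right [simp]: "\<omega> x (scale a y) = a * \<omega> x y"
  by (cases a) auto

lemma Q_scale [simp]: "Q (scale a x) = a * Q x"
  by (cases a) auto

section \<open>The lit-only game and the orbit criterion as a relation\<close>

definition shift :: "('a \<Rightarrow> bit) \<Rightarrow> 'a \<Rightarrow> 'a \<Rightarrow> bit" where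
  "shift \<alpha> x = (\<lambda>y. \<alpha> y + \<omega> x y)"

lemma shift_0 [simp]: "shift \<alpha> 0 = \<alpha>"
  by (simp add: shift_def)

lemma shift_shift [simp]: "shift (shift \<alpha> x) y = shift \<alpha> (x + y)"
  by (simp add: shift_def form_add_left add_ac)

lemma additive_shift: "additive \<alpha> \<Longrightarrow> additive (shift \<alpha> x)"
  by (simp add: additive_def shift_def form_add_right add_ac)

text \<open>
  If \<open>\<alpha>\<close> takes the value 1 at \<open>s\<close>, then \<open>\<alpha> \<circ> T\<^sub>s = \<alpha> + \<omega>(s)\<close>, and otherwise \<open>\<alpha> \<circ> T\<^sub>s = \<alpha>\<close>.
  So \<open>lit_reach S \<alpha> x\<close> lifts the orbit of \<open>\<alpha>\<close> along \<open>x \<mapsto> \<alpha> + \<omega>(x)\<close>; unlike the orbit it also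
  records the part of \<open>x\<close> in the radical of the form.
\<close>
inductive lit_reach :: "'a set \<Rightarrow> ('a \<Rightarrow> bit) \<Rightarrow> 'a \<Rightarrow> bool" for S \<alpha> where
  zero: "lit_reach S \<alpha> 0"
| step: "lit_reach S \<alpha> x \<Longrightarrow> s \<in> S \<Longrightarrow> shift \<alpha> x s = 1 \<Longrightarrow> lit_reach S \<alpha> (x + s)"

lemma lit_reach_single: "s \<in> S \<Longrightarrow> \<alpha> s = 1 \<Longrightarrow> lit_reach S \<alpha> s"
  using lit_reach.step[OF lit_reach.zero, of s S \<alpha>] by simp

lemma lit_reach_trans:
  assumes "lit_reach S \<alpha> x" and "lit_reach S (shift \<alpha> x) y"
  shows "lit_reach S \<alpha> (x + y)"
  using assms(2)
proof induction
  case zero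
  show ?case using assms(1) by simp
next
  case (step y s)
  then show ?case using lit_reach.step[of S \<alpha> "x + y" s] by (simp add: add_ac)
qed

text \<open>A move at \<open>s\<close> changes the functional by \<open>\<omega> s\<close>, which
  vanishes at \<open>s\<close>. So the value at \<open>s\<close> is still 1 and repeating the move
  undoes it.\<close>

lemma lit_reach_sym: "lit_reach S \<alpha> x \<Longrightarrow> lit_reach S (shift \<alpha> x) x"
proof (induction rule: lit_reach.induct)
  case zero
  show ?case by (rule lit_reach.zero)
next
  case (step x s)
  have "lit_reach S (shift \<alpha> (x + s)) s"
    using step.hyps by (intro lit_reach_single) (simp_all add: shift_def form_add_left form_self)
  then show ?case
    using lit_reach_trans[of S "shift \<alpha> (x + s)" s x] step.IH by (simp add: add_ac)
qed

lemma lit_reach_mono: "lit_reach S \<alpha> x \<Longrightarrow> S \<subseteq> S' \<Longrightarrow> lit_reach S' \<alpha> x"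
  by (induction rule: lit_reach.induct) (auto intro: lit_reach.intros)

lemma lit_reach_span: "lit_reach S \<alpha> x \<Longrightarrow> x \<in> span S"
  by (induction rule: lit_reach.induct) (auto intro: span_zero span_add span_base)

text \<open>\<open>x\<close> witnesses that \<open>\<alpha>\<close> and \<open>\<alpha> + \<omega>(x)\<close> satisfy the criterion of the theorem.\<close>
definition linked :: "('a \<Rightarrow> bit) \<Rightarrow> 'a \<Rightarrow> bool" where
  "linked \<alpha> x \<longleftrightarrow> Q x = \<alpha> x"

text \<open>The cross term \<open>\<omega> x y\<close> in \<open>Q (x + y)\<close> is exactly the
  difference between \<open>shift \<alpha> x y\<close> and \<open>\<alpha> y\<close>.\<close>

lemma linked_trans:
  assumes "additive \<alpha>" "linked \<alpha> x" "linked (shift \<alpha> x) y"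
  shows "linked \<alpha> (x + y)"
  using assms by (simp add: linked_def Q_add additive.add shift_def add_ac)

lemma linked_sym: "linked \<alpha> x \<Longrightarrow> linked (shift \<alpha> x) x"
  by (simp add: linked_def shift_def form_self)

lemma lit_reach_linked:
  assumes "additive \<alpha>" and "\<forall>s\<in>S. Q s = 1" and "lit_reach S \<alpha> x"
  shows "linked \<alpha> x"
  using assms(3)
proof induction
  case zero
  show ?case using additive.zero[OF assms(1)] by (simp add: linked_def)
next
  case (step x s)
  then show ?case using assms by (intro linked_trans) (simp_all add: linked_def)
qed

definition nonzero_on :: "'a set \<Rightarrow> ('a \<Rightarrow> bit) \<Rightarrow> bool" where
  "nonzero_on S \<alpha> \<longleftrightarrow> (\<exists>s\<in>S. \<alpha> s = 1)"

text \<open>The witness \<open>x\<close> itself has to be reached, not just the functional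
  \<open>shift \<alpha> x\<close>, which need not determine \<open>x\<close> when the form is
  degenerate. This is the statement that the induction on vertices carries.\<close>

definition lit_transitive :: "'a set \<Rightarrow> bool" where
  "lit_transitive S \<longleftrightarrow>
     (\<forall>\<alpha> x. additive \<alpha> \<longrightarrow> x \<in> span S \<longrightarrow> linked \<alpha> x \<longrightarrow> nonzero_on S \<alpha> \<longrightarrow>
        nonzero_on S (shift \<alpha> x) \<longrightarrow> lit_reach S \<alpha> x)"

lemma nonzero_on_mono: "nonzero_on S \<alpha> \<Longrightarrow> S \<subseteq> S' \<Longrightarrow> nonzero_on S' \<alpha>"
  by (auto simp: nonzero_on_def)

end

subsection \<open>Transvections\<close>

context f2_quadratic_space
begin

lemma dual_space_iff: "\<alpha> \<in> dual_space scale \<longleftrightarrow> additive \<alpha>"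
proof -
  have "vector_space ((*) :: bit \<Rightarrow> bit \<Rightarrow> bit)"
    by unfold_locales (simp_all add: algebra_simps)
  moreover have "\<alpha> (scale a x) = a * \<alpha> x" if "additive \<alpha>" for a x
    using additive.zero[OF that] by (cases a) auto
  ultimately show ?thesis
    using vector_space_axioms by (auto simp: dual_space_def Vector_Spaces.linear_iff additive_def)
qed

lemma additive_form: "additive (\<omega> x)"
  by (simp add: additive_def form_add_right)

lemma alternating: "alternating_form scale \<omega>"
proof -
  have "\<omega> x \<in> dual_space scale" for x
    by (simp add: dual_space_iff additive_form)
  moreover have "(\<lambda>x. \<omega> x y) = \<omega> y" for y
    by (auto simp: form_commute)
  ultimately show ?thesis
    by (simp add: alternating_form_def bilinear_form_def form_self dual_space_def)
qed

abbreviation T :: "'a \<Rightarrow> 'a \<Rightarrow> 'a" where "T \<equiv> transvection scale \<omega>"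

lemma T_in_GL: "T s \<in> carrier (GL scale)"
  using transvection_in_GL[OF vector_space_axioms alternating] .

lemma T_involutive: "T s \<circ> T s = id"
  by (auto simp: transvection_def form_add_left form_self fun_eq_iff add.assoc)

lemma inv_T: "inv\<^bsub>GL scale\<^esub> (T s) = T s"
  using group.inv_equality[OF group_GL[OF vector_space_axioms] _ T_in_GL T_in_GL] T_involutive
  by (simp add: GL_def)

text \<open>An isometry \<open>g\<close> conjugates \<open>T t\<close> to \<open>T (g t)\<close>;
  here \<open>g\<close> is the involution \<open>T s\<close>, which sends \<open>t\<close> to
  \<open>s + t\<close>.\<close>

lemma T_add:
  assumes "\<omega> s t = 1"
  shows "T (s + t) = T s \<circ> T t \<circ> T s"
proof
  fix x
  have "\<omega> t s = 1" using assms by (simp add: form_commute)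
  with assms show "T (s + t) x = (T s \<circ> T t \<circ> T s) x"
    by (cases "\<omega> x s"; cases "\<omega> x t")
      (simp_all add: transvection_def form_add_left form_add_right form_self add_ac)
qed

lemma comp_T:
  assumes "additive \<alpha>"
  shows "\<alpha> \<circ> T s = shift \<alpha> (scale (\<alpha> s) s)"
proof
  fix x
  show "(\<alpha> \<circ> T s) x = shift \<alpha> (scale (\<alpha> s) s) x"
    using additive.zero[OF assms]
    by (cases "\<omega> x s"; cases "\<alpha> s")
      (simp_all add: transvection_def shift_def additive.add[OF assms] form_commute[of s])
qed

lemma id_in_Gamma: "id \<in> Gamma scale \<omega> S"
  using generate.one[of "GL scale"] by (simp add: Gamma_def GL_def)

lemma T_in_Gamma: "s \<in> S \<Longrightarrow> T s \<in> Gamma scale \<omega> S"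
  by (simp add: Gamma_def generate.incl)

lemma comp_in_Gamma: "g \<in> Gamma scale \<omega> S \<Longrightarrow> h \<in> Gamma scale \<omega> S \<Longrightarrow> g \<circ> h \<in> Gamma scale \<omega> S"
  using generate.eng[of g "GL scale" _ h] by (simp add: Gamma_def GL_def)

lemma Gamma_subset:
  assumes "\<And>s. s \<in> S \<Longrightarrow> T s \<in> Gamma scale \<omega> S'"
  shows "Gamma scale \<omega> S \<subseteq> Gamma scale \<omega> S'"
proof -
  interpret GL: group "GL scale" by (rule group_GL[OF vector_space_axioms])
  show ?thesis
    using assms T_in_GL unfolding Gamma_def
    by (intro GL.generate_subgroup_incl GL.generate_is_subgroup) auto
qed

lemma t_step_Gamma:
  assumes "t_step \<omega> S S'"
  shows "Gamma scale \<omega> S = Gamma scale \<omega> S'"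
proof -
  from assms obtain s t where st: "s \<in> S" "t \<in> S" "\<omega> s t = 1" and S': "S' = insert (s + t) (S - {t})"
    by (auto simp: t_step_def)
  have s: "s \<in> S'" using st form_self[of s] unfolding S' by auto
  \<comment> \<open>The replacement is reversible: \<open>\<omega> s (s + t) = 1\<close> and
    \<open>s + (s + t) = t\<close>.\<close>
  have "T t = T s \<circ> T (s + t) \<circ> T s"
    using T_add[of s "s + t"] st(3) by (simp add: form_add_right form_self)
  then have "T t \<in> Gamma scale \<omega> S'"
    using s S' by (auto intro!: comp_in_Gamma T_in_Gamma)
  then have "Gamma scale \<omega> S \<subseteq> Gamma scale \<omega> S'"
    using S' by (intro Gamma_subset) (metis Diff_iff T_in_Gamma empty_iff insert_iff)
  moreover have "T (s + t) \<in> Gamma scale \<omega> S"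
    unfolding T_add[OF st(3)] using st by (intro comp_in_Gamma T_in_Gamma)
  then have "Gamma scale \<omega> S' \<subseteq> Gamma scale \<omega> S"
    using S' by (intro Gamma_subset) (auto intro: T_in_Gamma)
  ultimately show ?thesis by blast
qed

text \<open>Since \<open>Q (s + t) = 1 + Q t + 1\<close>, the quadratic form of a basis also takes
  the value 1 on every t-equivalent basis.\<close>

lemma t_step_Q:
  assumes "t_step \<omega> S S'"
  shows "(\<forall>s\<in>S. Q s = 1) \<longleftrightarrow> (\<forall>s\<in>S'. Q s = 1)"
proof -
  from assms obtain s t where st: "s \<in> S" "t \<in> S" "\<omega> s t = 1" and S': "S' = insert (s + t) (S - {t})"
    by (auto simp: t_step_def)
  have "s \<noteq> t" using st form_self[of s] by auto
  moreover have "Q (s + t) = Q t" if "Q s = 1"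
    using that st(3) by (simp add: Q_add add_ac)
  ultimately show ?thesis using st(1,2) unfolding S' by (metis Diff_iff insert_iff singletonD)
qed

lemma t_equivalent_invariants:
  assumes "t_equivalent \<omega> S S'"
  shows "Gamma scale \<omega> S = Gamma scale \<omega> S'"
    and "(\<forall>s\<in>S. Q s = 1) \<longleftrightarrow> (\<forall>s\<in>S'. Q s = 1)"
proof -
  have "Gamma scale \<omega> A = Gamma scale \<omega> B \<and> ((\<forall>s\<in>A. Q s = 1) \<longleftrightarrow> (\<forall>s\<in>B. Q s = 1))"
    if "(t_step \<omega>)\<^sup>*\<^sup>* A B" for A B
    using that by induction (auto simp: t_step_Gamma t_step_Q)
  with assms show "Gamma scale \<omega> S = Gamma scale \<omega> S'" "(\<forall>s\<in>S. Q s = 1) \<longleftrightarrow> (\<forall>s\<in>S'. Q s = 1)"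
    by (auto simp: t_equivalent_def)
qed

text \<open>In \<open>\<alpha> \<circ> h1 \<circ> h2\<close> the map \<open>h2\<close> meets a
  functional already shifted by \<open>h1\<close>, so the induction ranges over all functionals, and
  the witnesses add up by transitivity. Inverses of generators are generators because transvections
  are involutions.\<close>

lemma Gamma_linked:
  assumes Q_S: "\<forall>s\<in>S. Q s = 1" and "g \<in> Gamma scale \<omega> S" and "additive \<alpha>"
  shows "\<exists>x. \<alpha> \<circ> g = shift \<alpha> x \<and> linked \<alpha> x"
  using assms(2,3) unfolding Gamma_def
proof (induction arbitrary: \<alpha> rule: generate.induct)
  have T: "\<exists>x. \<alpha> \<circ> T s = shift \<alpha> x \<and> linked \<alpha> x" if "s \<in> S" "additive \<alpha>" for s \<alpha>
    using that Q_S additive.zero[OF that(2)]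
    by (intro exI[of _ "scale (\<alpha> s) s"]) (cases "\<alpha> s"; simp add: comp_T linked_def)
  {
    case one
    show ?case
      using additive.zero[OF one] by (intro exI[of _ 0]) (simp add: GL_def linked_def)
  next
    case (incl h)
    then show ?case using T by blast
  next
    case (inv h)
    then obtain s where "s \<in> S" "inv\<^bsub>GL scale\<^esub> h = T s" using inv_T by auto
    then show ?case using T inv.prems by metis
  next
    case (eng h1 h2)
    obtain x1 where x1: "\<alpha> \<circ> h1 = shift \<alpha> x1" "linked \<alpha> x1"
      using eng.IH(1)[OF eng.prems] by blast
    obtain x2 where x2: "shift \<alpha> x1 \<circ> h2 = shift (shift \<alpha> x1) x2" "linked (shift \<alpha> x1) x2"
      using eng.IH(2)[OF additive_shift[OF eng.prems]] by blast
    have "\<alpha> \<circ> (h1 \<circ> h2) = shift \<alpha> (x1 + x2)"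
      using x1(1) x2(1) by (simp flip: o_assoc add: o_assoc[of \<alpha>])
    moreover have "h1 \<otimes>\<^bsub>GL scale\<^esub> h2 = h1 \<circ> h2"
      by (simp add: GL_def)
    ultimately show ?case
      using linked_trans[OF eng.prems x1(2) x2(2)] by metis
  }
qed

lemma lit_reach_Gamma:
  assumes "lit_reach S \<alpha> x" and "additive \<alpha>"
  shows "\<exists>g\<in>Gamma scale \<omega> S. \<alpha> \<circ> g = shift \<alpha> x"
  using assms(1)
proof induction
  case zero
  show ?case using id_in_Gamma by (intro bexI[of _ id]) simp_all
next
  case (step x s)
  then obtain g where g: "g \<in> Gamma scale \<omega> S" "\<alpha> \<circ> g = shift \<alpha> x" by blast
  have "\<alpha> \<circ> (g \<circ> T s) = shift \<alpha> (x + s)"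
    unfolding o_assoc g(2) comp_T[OF additive_shift[OF assms(2)]] using step.hyps(3) by simp
  with g(1) step.hyps(2) show ?case by (blast intro: comp_in_Gamma T_in_Gamma)
qed

text \<open>An orbit comes with a base point, so \<open>\<alpha>\<close> and \<open>\<beta>\<close>
  appear as images of a common \<open>\<gamma>\<close>. This avoids verifying the axioms of a group
  action.\<close>

lemma orbits_Gamma_dual_iff:
  "(\<exists>Orb \<in> orbits (Gamma_dual scale \<omega> S) (dual_space scale) (\<lambda>h. h). \<alpha> \<in> Orb \<and> \<beta> \<in> Orb) \<longleftrightarrow>
   (\<exists>\<gamma>. additive \<gamma> \<and> (\<exists>g\<in>Gamma scale \<omega> S. \<alpha> = \<gamma> \<circ> g) \<and> (\<exists>h\<in>Gamma scale \<omega> S. \<beta> = \<gamma> \<circ> h))"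
proof -
  have "orbit (Gamma_dual scale \<omega> S) (\<lambda>h. h) \<gamma> = {\<gamma> \<circ> g | g. g \<in> Gamma scale \<omega> S}"
    if "\<gamma> \<in> dual_space scale" for \<gamma>
  proof -
    have "orbit (Gamma_dual scale \<omega> S) (\<lambda>h. h) \<gamma> = {dual_map scale g \<gamma> | g. g \<in> Gamma scale \<omega> S}"
      by (auto simp: orbit_def Gamma_dual_def)
    with that show ?thesis by (simp add: dual_map_def)
  qed
  then show ?thesis
    by (simp add: orbits_def dual_space_iff[symmetric] Bex_def) blast
qed

lemma nonzero_on_spanning:
  assumes "span S = UNIV" and \<alpha>: "additive \<alpha>" and "\<alpha> \<noteq> (\<lambda>_. 0)"
  shows "nonzero_on S \<alpha>"
proof (rule ccontr)
  assume "\<not> nonzero_on S \<alpha>"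
  then have zero: "\<alpha> s = 0" if "s \<in> S" for s using that by (auto simp: nonzero_on_def)
  have scale: "\<alpha> (scale a x) = a * \<alpha> x" for a x
    using additive.zero[OF \<alpha>] by (cases a) auto
  have "\<alpha> x = 0" if "x \<in> span S" for x
    using that by (induction rule: span_induct_alt)
      (simp_all add: additive.zero[OF \<alpha>] additive.add[OF \<alpha>] scale zero)
  with assms(1,3) show False by auto
qed

end

subsection \<open>The space of type \<open>E\<^sub>6\<close>\<close>

locale e6_configuration = f2_quadratic_space +
  fixes v1 v2 v3 v4 v5 v6 :: 'a
  assumes edges: "\<omega> v1 v2 = 1" "\<omega> v2 v3 = 1" "\<omega> v3 v4 = 1" "\<omega> v4 v5 = 1" "\<omega> v3 v6 = 1"
    and non_edges: "\<omega> v1 v3 = 0" "\<omega> v1 v4 = 0" "\<omega> v1 v5 = 0" "\<omega> v1 v6 = 0" "\<omega> v2 v4 = 0"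
      "\<omega> v2 v5 = 0" "\<omega> v2 v6 = 0" "\<omega> v3 v5 = 0" "\<omega> v4 v6 = 0" "\<omega> v5 v6 = 0"
    and Q_v: "Q v1 = 1" "Q v2 = 1" "Q v3 = 1" "Q v4 = 1" "Q v5 = 1" "Q v6 = 1"
begin

abbreviation "E \<equiv> {v1, v2, v3, v4, v5, v6}"

lemmas form_v = edges non_edges form_self edges[THEN trans[OF form_commute]]
  non_edges[THEN trans[OF form_commute]]

definition comb :: "bit \<Rightarrow> bit \<Rightarrow> bit \<Rightarrow> bit \<Rightarrow> bit \<Rightarrow> bit \<Rightarrow> 'a" where
  "comb a1 a2 a3 a4 a5 a6 =
     scale a1 v1 + scale a2 v2 + scale a3 v3 + scale a4 v4 + scale a5 v5 + scale a6 v6"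

lemma comb_in_span: "comb a1 a2 a3 a4 a5 a6 \<in> span E"
  unfolding comb_def by (intro span_add span_scale span_base) auto

lemma comb_cases:
  assumes "x \<in> span E"
  obtains a1 a2 a3 a4 a5 a6 where "x = comb a1 a2 a3 a4 a5 a6"
proof -
  from assms obtain a1 a2 a3 a4 a5 a6
    where "x - scale a1 v1 - scale a2 v2 - scale a3 v3 - scale a4 v4 - scale a5 v5 - scale a6 v6 = 0"
    by (auto simp: span_breakdown_eq)
  then have "x = comb a1 a2 a3 a4 a5 a6"
    unfolding eq_iff_add_eq_0[of x] by (simp add: comb_def add_ac)
  then show ?thesis by (rule that)
qed

lemma form_comb:
  "\<omega> (comb a1 a2 a3 a4 a5 a6) v1 = a2"
  "\<omega> (comb a1 a2 a3 a4 a5 a6) v2 = a1 + a3"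
  "\<omega> (comb a1 a2 a3 a4 a5 a6) v3 = a2 + a4 + a6"
  "\<omega> (comb a1 a2 a3 a4 a5 a6) v4 = a3 + a5"
  "\<omega> (comb a1 a2 a3 a4 a5 a6) v5 = a4"
  "\<omega> (comb a1 a2 a3 a4 a5 a6) v6 = a3"
  by (simp_all add: comb_def form_add_left form_v)

lemma additive_comb:
  assumes "additive \<alpha>"
  shows "\<alpha> (comb a1 a2 a3 a4 a5 a6) =
    a1 * \<alpha> v1 + a2 * \<alpha> v2 + a3 * \<alpha> v3 + a4 * \<alpha> v4 + a5 * \<alpha> v5 + a6 * \<alpha> v6"
proof -
  have "\<alpha> (scale a x) = a * \<alpha> x" for a x
    using additive.zero[OF assms] by (cases a) auto
  then show ?thesis by (simp add: comb_def additive.add[OF assms])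
qed

lemma Q_comb:
  "Q (comb a1 a2 a3 a4 a5 a6) = a1 + a2 + a3 + a4 + a5 + a6 +
     (a1 * a2 + a2 * a3 + a3 * a4 + a4 * a5 + a3 * a6)"
  by (simp add: comb_def Q_add Q_v form_add_left form_add_right form_v mult.commute add_ac)

text \<open>The values at \<open>v1\<close>, \<open>v5\<close>, \<open>v6\<close> give the
  coefficients \<open>a2\<close>, \<open>a4\<close>, \<open>a3\<close>; those at \<open>v2\<close>,
  \<open>v4\<close>, \<open>v3\<close> then give \<open>a1\<close>, \<open>a5\<close>,
  \<open>a6\<close>.\<close>

lemma e6_nondegenerate:
  assumes "x \<in> span E" "x \<noteq> 0"
  shows "nonzero_on E (\<omega> x)"
proof -
  obtain a1 a2 a3 a4 a5 a6 where x: "x = comb a1 a2 a3 a4 a5 a6"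
    using assms(1) by (rule comb_cases)
  have "comb 0 0 0 0 0 0 = 0" by (simp add: comb_def)
  with assms(2) show ?thesis
    unfolding nonzero_on_def x
    by (cases a1; cases a2; cases a3; cases a4; cases a5; cases a6) (auto simp: form_comb)
qed

lemma e6_representative:
  assumes "additive \<alpha>"
  obtains g where "g \<in> span E" and "\<And>x. x \<in> span E \<Longrightarrow> \<omega> g x = \<alpha> x"
proof
  \<comment> \<open>The coefficients solve this triangular system for the prescribed values of
    \<open>\<alpha>\<close>.\<close>
  define g where "g = comb (\<alpha> v2 + \<alpha> v6) (\<alpha> v1) (\<alpha> v6) (\<alpha> v5) (\<alpha> v4 + \<alpha> v6) (\<alpha> v1 + \<alpha> v3 + \<alpha> v5)"
  show "g \<in> span E" unfolding g_def by (rule comb_in_span)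
  fix x assume "x \<in> span E"
  then obtain a1 a2 a3 a4 a5 a6 where x: "x = comb a1 a2 a3 a4 a5 a6"
    by (rule comb_cases)
  have "\<omega> g x = a1 * \<omega> g v1 + a2 * \<omega> g v2 + a3 * \<omega> g v3 + a4 * \<omega> g v4 + a5 * \<omega> g v5 + a6 * \<omega> g v6"
    unfolding x by (rule additive_comb[OF additive_form])
  then show "\<omega> g x = \<alpha> x"
    unfolding x additive_comb[OF assms] by (simp add: g_def form_comb add_ac)
qed

text \<open>
  The length of a shortest play of the lit-only game on \<open>E\<^sub>6\<close>, from the labels \<open>a1, \<dots>, a6\<close> to
  one of the positions \<open>(0,0,0,0,1,0)\<close> and \<open>(0,0,0,0,0,1)\<close>.
\<close>
definition e6_rank :: "bit \<Rightarrow> bit \<Rightarrow> bit \<Rightarrow> bit \<Rightarrow> bit \<Rightarrow> bit \<Rightarrow> nat" where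
  "e6_rank a1 a2 a3 a4 a5 a6 =
    [0, 0, 0, 11, 10, 12, 1, 12, 10, 1, 10, 10, 2, 13, 9, 11,
     10, 4, 4, 7, 8, 10, 3, 8, 14, 3, 10, 8, 2, 9, 9, 9,
     16, 5, 8, 6, 4, 7, 7, 7, 10, 6, 6, 5, 6, 8, 5, 6,
     15, 4, 9, 7, 3, 8, 8, 8, 9, 5, 5, 6, 7, 9, 4, 7] !
    (32 * of_bool (a1 = 1) + 16 * of_bool (a2 = 1) + 8 * of_bool (a3 = 1)
     + 4 * of_bool (a4 = 1) + 2 * of_bool (a5 = 1) + of_bool (a6 = 1))"

text \<open>Each disjunct is a move: a vertex with label 1 flips the labels of its neighbours. The
  61 remaining positions are checked one by one.\<close>

lemma e6_rank_decreases:
  assumes "(a1, a2, a3, a4, a5, a6) \<notin> {(0,0,0,0,0,0), (0,0,0,0,1,0), (0,0,0,0,0,1)}"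
  shows "a1 = 1 \<and> e6_rank a1 (a2 + 1) a3 a4 a5 a6 < e6_rank a1 a2 a3 a4 a5 a6 \<or>
    a2 = 1 \<and> e6_rank (a1 + 1) a2 (a3 + 1) a4 a5 a6 < e6_rank a1 a2 a3 a4 a5 a6 \<or>
    a3 = 1 \<and> e6_rank a1 (a2 + 1) a3 (a4 + 1) a5 (a6 + 1) < e6_rank a1 a2 a3 a4 a5 a6 \<or>
    a4 = 1 \<and> e6_rank a1 a2 (a3 + 1) a4 (a5 + 1) a6 < e6_rank a1 a2 a3 a4 a5 a6 \<or>
    a5 = 1 \<and> e6_rank a1 a2 a3 (a4 + 1) a5 a6 < e6_rank a1 a2 a3 a4 a5 a6 \<or>
    a6 = 1 \<and> e6_rank a1 a2 (a3 + 1) a4 a5 a6 < e6_rank a1 a2 a3 a4 a5 a6"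
  using assms
  by (cases a1; cases a2; cases a3; cases a4; cases a5; cases a6) (simp_all add: e6_rank_def)

lemma comb_eq_iff:
  "comb a1 a2 a3 a4 a5 a6 = comb b1 b2 b3 b4 b5 b6 \<longleftrightarrow>
     a1 = b1 \<and> a2 = b2 \<and> a3 = b3 \<and> a4 = b4 \<and> a5 = b5 \<and> a6 = b6"
  using form_comb[of a1 a2 a3 a4 a5 a6] form_comb[of b1 b2 b3 b4 b5 b6]
  by (metis add_right_cancel add_left_cancel)

lemma comb_0: "comb 0 0 0 0 0 0 = 0"
  by (simp add: comb_def)

text \<open>For use when a vertex \<open>v\<close> is added: \<open>p\<close> will represent
  \<open>\<omega> v\<close> on the span of \<open>E\<close>, and \<open>w\<close> the functional to
  be reached. Excluding 0 and \<open>p\<close> keeps this functional nonzero on \<open>E\<close>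
  before and after the move at \<open>v\<close>.\<close>

lemma e6_exists_vector:
  assumes "p \<in> span E" and "p = 0 \<Longrightarrow> c = 0"
  obtains w where "w \<in> span E" "w \<noteq> 0" "w \<noteq> p" "Q w = q" "\<omega> w p = c"
proof -
  obtain p1 p2 p3 p4 p5 p6 where p: "p = comb p1 p2 p3 p4 p5 p6"
    using assms(1) by (rule comb_cases)
  have form_p: "\<omega> w p = p1 * \<omega> w v1 + p2 * \<omega> w v2 + p3 * \<omega> w v3 + p4 * \<omega> w v4 + p5 * \<omega> w v5 + p6 * \<omega> w v6" for w
    unfolding p by (rule additive_comb[OF additive_form])
  \<comment> \<open>These fourteen vectors suffice for all \<open>p\<close>, \<open>c\<close> and
    \<open>q\<close>, which keeps the case check small.\<close>
  have "\<exists>w\<in>{comb 0 0 0 0 0 1, comb 0 0 0 0 1 1, comb 0 0 0 0 1 0, comb 0 1 0 0 0 1,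
     comb 0 0 0 1 0 0, comb 0 0 0 1 0 1, comb 0 0 0 1 1 0, comb 0 0 0 1 1 1,
     comb 0 0 1 0 0 0, comb 0 0 1 0 1 0, comb 0 0 1 0 1 1, comb 0 1 0 0 0 0,
     comb 1 0 0 0 0 0, comb 1 0 0 0 0 1}.
      w \<noteq> 0 \<and> w \<noteq> p \<and> Q w = q \<and> \<omega> w p = c"
    using assms(2) unfolding form_p unfolding p comb_0[symmetric]
    by (simp add: comb_eq_iff form_comb Q_comb)
      (cases p1; cases p2; cases p3; cases p4; cases p5; cases p6; cases c; cases q; simp)
  with that comb_in_span show ?thesis by blast
qed


lemma e6_to_representative:
  assumes "additive \<alpha>" and "nonzero_on E \<alpha>"
  shows "\<exists>z. lit_reach E \<alpha> z \<and> (\<forall>i\<in>{v1, v2, v3, v4}. shift \<alpha> z i = 0) \<and>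
    shift \<alpha> z v5 \<noteq> shift \<alpha> z v6"
  using assms
proof (induction "e6_rank (\<alpha> v1) (\<alpha> v2) (\<alpha> v3) (\<alpha> v4) (\<alpha> v5) (\<alpha> v6)"
    arbitrary: \<alpha> rule: less_induct)
  case less
  show ?case
  proof (cases "(\<alpha> v1, \<alpha> v2, \<alpha> v3, \<alpha> v4, \<alpha> v5, \<alpha> v6) \<in> {(0,0,0,0,1,0), (0,0,0,0,0,1)}")
    case True
    then show ?thesis by (intro exI[of _ 0]) (auto intro: lit_reach.zero)
  next
    case False
    with less.prems(2) have "(\<alpha> v1, \<alpha> v2, \<alpha> v3, \<alpha> v4, \<alpha> v5, \<alpha> v6) \<notin>
        {(0,0,0,0,0,0), (0,0,0,0,1,0), (0,0,0,0,0,1)}"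
      by (auto simp: nonzero_on_def)
    from e6_rank_decreases[OF this] obtain s where s: "s \<in> E" "\<alpha> s = 1"
      and lt: "e6_rank (shift \<alpha> s v1) (shift \<alpha> s v2) (shift \<alpha> s v3) (shift \<alpha> s v4)
        (shift \<alpha> s v5) (shift \<alpha> s v6) < e6_rank (\<alpha> v1) (\<alpha> v2) (\<alpha> v3) (\<alpha> v4) (\<alpha> v5) (\<alpha> v6)"
      by (elim disjE) (force simp: shift_def form_v)+
    \<comment> \<open>The move at \<open>s\<close> leaves the label 1 of \<open>s\<close>
      unchanged.\<close>
    have "nonzero_on E (shift \<alpha> s)"
      using s by (force simp: nonzero_on_def shift_def form_self)
    from less.hyps[OF lt additive_shift[OF less.prems(1)] this] obtain z where z:
        "lit_reach E (shift \<alpha> s) z" "\<forall>i\<in>{v1, v2, v3, v4}. shift \<alpha> (s + z) i = 0"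
        "shift \<alpha> (s + z) v5 \<noteq> shift \<alpha> (s + z) v6"
      by auto
    from lit_reach_trans[OF lit_reach_single[of s E \<alpha>, OF s] z(1)] z(2,3) show ?thesis by blast
  qed
qed

lemma e6_lit_transitive: "lit_transitive E"
  unfolding lit_transitive_def
proof (intro allI impI)
  fix \<alpha> x
  assume \<alpha>: "additive \<alpha>" and x: "x \<in> span E" "linked \<alpha> x"
    and nz: "nonzero_on E \<alpha>" "nonzero_on E (shift \<alpha> x)"
  have QE: "\<forall>s\<in>E. Q s = 1" using Q_v by auto
  obtain z1 where z1: "lit_reach E \<alpha> z1" "\<forall>i\<in>{v1, v2, v3, v4}. shift \<alpha> z1 i = 0"
    "shift \<alpha> z1 v5 \<noteq> shift \<alpha> z1 v6"
    using e6_to_representative[OF \<alpha> nz(1)] by blast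
  obtain z2 where z2: "lit_reach E (shift \<alpha> x) z2" "\<forall>i\<in>{v1, v2, v3, v4}. shift \<alpha> (x + z2) i = 0"
    "shift \<alpha> (x + z2) v5 \<noteq> shift \<alpha> (x + z2) v6"
    using e6_to_representative[OF additive_shift[OF \<alpha>] nz(2)] by auto
  \<comment> \<open>The vector \<open>y\<close> leads from the first representative to the
    second.\<close>
  define y where "y = z1 + (x + z2)"
  have "linked \<alpha> (x + z2)"
    using linked_trans[OF \<alpha> x(2) lit_reach_linked[OF additive_shift[OF \<alpha>] QE z2(1)]] .
  moreover have "linked (shift \<alpha> z1) z1"
    using linked_sym[OF lit_reach_linked[OF \<alpha> QE z1(1)]] .
  ultimately have linked_y: "linked (shift \<alpha> z1) y"
    unfolding y_def using linked_trans[OF additive_shift[OF \<alpha>], of z1 z1 "x + z2"] by simp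
  have y_span: "y \<in> span E"
    unfolding y_def using x(1) lit_reach_span z1(1) z2(1) by (intro span_add) auto
  have form_y: "\<omega> y i = shift \<alpha> z1 i + shift \<alpha> (x + z2) i" for i
    by (simp add: y_def shift_def form_add_left add_ac)
  \<comment> \<open>If the representatives agree on \<open>E\<close>, nondegeneracy gives the claim.
    If they differ, \<open>y\<close> must be \<open>comb 1 0 1 1 1 1\<close>, where \<open>Q\<close>
    is 0 but the functional is 1, against linkedness.\<close>
  have "y = 0"
  proof (cases "shift \<alpha> z1 v5 = shift \<alpha> (x + z2) v5")
    case True
    then have "shift \<alpha> z1 v6 = shift \<alpha> (x + z2) v6"
      using z1(3) z2(3)
      by (cases "shift \<alpha> z1 v6"; cases "shift \<alpha> (x + z2) v6") auto
    with True have "\<not> nonzero_on E (\<omega> y)"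
      using z1(2) z2(2) by (simp add: nonzero_on_def form_y)
    with e6_nondegenerate y_span show ?thesis by blast
  next
    case False
    then have labels: "\<omega> y v1 = 0" "\<omega> y v2 = 0" "\<omega> y v3 = 0" "\<omega> y v4 = 0" "\<omega> y v5 = 1" "\<omega> y v6 = 1"
      using z1(2,3) z2(2,3) unfolding form_y
      by (cases "shift \<alpha> z1 v5"; cases "shift \<alpha> z1 v6"; cases "shift \<alpha> (x + z2) v6"; simp)+
    obtain a1 a2 a3 a4 a5 a6 where y: "y = comb a1 a2 a3 a4 a5 a6"
      using y_span by (rule comb_cases)
    have y: "y = comb 1 0 1 1 1 1"
      using labels unfolding y form_comb
      by (cases a1; cases a2; cases a3; cases a4; cases a5; cases a6) simp_all
    have "shift \<alpha> z1 y = shift \<alpha> z1 v5 + shift \<alpha> z1 v6"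
      unfolding y additive_comb[OF additive_shift[OF \<alpha>]] using z1(2) by simp
    then have "shift \<alpha> z1 y = 1" using z1(3) by (simp add: bit_add_eq_1_iff)
    moreover have "Q y = 0" unfolding y Q_comb by simp
    ultimately show ?thesis using linked_y by (simp add: linked_def)
  qed
  \<comment> \<open>Both plays end at the same witness, so the second one can be run
    backwards.\<close>
  then have "x + z2 = z1" unfolding y_def eq_iff_add_eq_0[of "x + z2"] by (simp add: add_ac)
  then have "lit_reach E (shift \<alpha> z1) z2"
    using lit_reach_sym[OF z2(1)] by simp
  from lit_reach_trans[OF z1(1) this] \<open>x + z2 = z1\<close>[symmetric] show "lit_reach E \<alpha> x"
    by (simp add: add.assoc)
qed

subsection \<open>Adding a vertex\<close>

context
  fixes S :: "'a set" and u v :: 'a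
  assumes S: "lit_transitive S" and E_S: "E \<subseteq> S" and Q_S: "\<forall>s\<in>S. Q s = 1"
    and u: "u \<in> S" and edge: "\<omega> u v = 1" and Q_v': "Q v = 1"
begin

text \<open>Prepares a move at \<open>v\<close> such that the functional is still nonzero on the old
  vertices after that move.\<close>

lemma light_new_vertex:
  assumes \<gamma>: "additive \<gamma>" and nz: "nonzero_on S \<gamma>"
  obtains z where "lit_reach S \<gamma> z" "shift \<gamma> z v = 1" "nonzero_on S (shift \<gamma> (z + v))"
proof -
  obtain g where g: "g \<in> span E" "\<And>y. y \<in> span E \<Longrightarrow> \<omega> g y = \<gamma> y"
    using e6_representative[OF \<gamma>] by blast
  obtain p where p: "p \<in> span E" "\<And>y. y \<in> span E \<Longrightarrow> \<omega> p y = \<omega> v y"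
    using e6_representative[OF additive_form] by blast
  \<comment> \<open>The neighbour \<open>u\<close> corrects the value at \<open>v\<close>. The rest
    of the witness, \<open>z0\<close> in the span of \<open>E\<close>, must keep this value and make
    the sum linked.\<close>
  define z1 where "z1 = (if \<gamma> v = 1 then 0 else u)"
  have z1: "z1 \<in> span S" "\<gamma> v + \<omega> z1 v = 1"
    using u edge by (auto simp: z1_def intro: span_zero span_base)
  obtain g1 where g1: "g1 \<in> span E" "\<And>y. y \<in> span E \<Longrightarrow> \<omega> g1 y = shift \<gamma> z1 y"
    using e6_representative[OF additive_shift[OF \<gamma>]] by blast
  \<comment> \<open>With \<open>w = g1 + z0\<close>, completing the square turns linkedness of
    \<open>z1 + z0\<close> into a prescribed value of \<open>Q w\<close>, and
    \<open>\<omega> w p = \<omega> g1 p\<close> says that \<open>z0\<close> is orthogonal to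
    \<open>v\<close>. On the span of \<open>E\<close>, \<open>w\<close> and \<open>w + p\<close>
    represent the functionals before and after the move at \<open>v\<close>.\<close>
  obtain w where w: "w \<in> span E" "w \<noteq> 0" "w \<noteq> p"
      "Q w = Q g1 + Q z1 + \<gamma> z1" "\<omega> w p = \<omega> g1 p"
    using e6_exists_vector[OF p(1), of "\<omega> g1 p"] by (metis form_0_right)
  define z0 where "z0 = g1 + w"
  define z where "z = z1 + z0"
  have z0: "z0 \<in> span E" unfolding z0_def using g1(1) w(1) by (rule span_add)
  have w_eq: "w = g1 + z0" by (simp add: z0_def)
  have form_w: "\<omega> w y = shift \<gamma> z y" if "y \<in> span E" for y
    using g1(2)[OF that] by (simp add: w_eq z_def shift_def form_add_left add_ac)
  have "Q z0 + \<omega> g1 z0 = Q z1 + \<gamma> z1"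
    using w(4) unfolding w_eq Q_add by (simp add: add_ac)
  moreover have bits: "d + a + c = e + b" if "a + (b + c) = d + e" for a b c d e :: bit
    using that by (cases a; cases b; cases c; cases d; cases e) auto
  ultimately have "linked \<gamma> z"
    using g1(2)[OF z0] bits by (simp add: linked_def z_def Q_add additive.add[OF \<gamma>] shift_def)
  moreover have "z \<in> span S"
    unfolding z_def using z0 span_mono[OF E_S] z1(1) by (intro span_add) auto
  moreover have "nonzero_on E (shift \<gamma> z)"
    using e6_nondegenerate[OF w(1,2)] form_w by (auto simp: nonzero_on_def span_base)
  ultimately have reach: "lit_reach S \<gamma> z"
    using S \<gamma> nz nonzero_on_mono[OF _ E_S] by (simp add: lit_transitive_def)
  have "\<omega> p z0 = 0" using w(5) unfolding w_eq form_add_left form_commute[of p] by simp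
  then have "\<omega> v z0 = 0" using p(2)[OF z0] by simp
  then have lit: "shift \<gamma> z v = 1"
    using z1(2) by (simp add: z_def shift_def form_add_left form_commute[of v])
  have "w + p \<noteq> 0" using w(3) eq_iff_add_eq_0 by blast
  then have "nonzero_on E (\<omega> (w + p))"
    using w(1) p(1) by (intro e6_nondegenerate span_add)
  moreover have "\<omega> (w + p) y = shift \<gamma> (z + v) y" if "y \<in> span E" for y
    using form_w[OF that] p(2)[OF that] by (simp add: shift_def form_add_left add_ac)
  ultimately have "nonzero_on E (shift \<gamma> (z + v))"
    by (auto simp: nonzero_on_def span_base)
  then show ?thesis using that reach lit nonzero_on_mono[OF _ E_S] by blast
qed

text \<open>If \<open>\<gamma>\<close> vanishes on \<open>S\<close>, its value at \<open>v\<close>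
  is 1, and the move at \<open>v\<close> makes the value at the neighbour \<open>u\<close> equal to
  1.\<close>

lemma reach_nonzero_on_old:
  assumes "nonzero_on (insert v S) \<gamma>"
  obtains z where "lit_reach (insert v S) \<gamma> z" "nonzero_on S (shift \<gamma> z)"
proof (cases "nonzero_on S \<gamma>")
  case True
  then show ?thesis using that[of 0] lit_reach.zero by simp
next
  case False
  then have v: "\<gamma> v = 1" using assms by (auto simp: nonzero_on_def)
  have "shift \<gamma> v u = 1" using False u edge by (auto simp: nonzero_on_def shift_def form_commute[of v])
  with u have "nonzero_on S (shift \<gamma> v)" by (auto simp: nonzero_on_def)
  with v show ?thesis using that[of v] lit_reach_single[of v "insert v S"] by simp
qed

text \<open>There are only two cosets of \<open>span S\<close> to consider, and a move at
  \<open>v\<close>, prepared by \<open>light_new_vertex\<close>, exchanges them.\<close>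

lemma reach_old_coset:
  assumes \<gamma>: "additive \<gamma>" and nz: "nonzero_on (insert v S) \<gamma>" and x: "x \<in> span (insert v S)"
  obtains z where "lit_reach (insert v S) \<gamma> z" "nonzero_on S (shift \<gamma> z)" "x + z \<in> span S"
proof -
  obtain z1 where z1: "lit_reach (insert v S) \<gamma> z1" "nonzero_on S (shift \<gamma> z1)"
    using reach_nonzero_on_old[OF nz] by blast
  have "x + z1 \<in> span (insert v S)" using x lit_reach_span[OF z1(1)] by (rule span_add)
  then obtain k where k: "x + z1 - scale k v \<in> span S" by (auto simp: span_breakdown_eq)
  show ?thesis
  proof (cases k)
    case zero
    with k z1 show ?thesis by (intro that) auto
  next
    case one
    obtain z where z: "lit_reach S (shift \<gamma> z1) z" "shift (shift \<gamma> z1) z v = 1"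
        "nonzero_on S (shift (shift \<gamma> z1) (z + v))"
      using light_new_vertex[OF additive_shift[OF \<gamma>] z1(2)] by blast
    have "lit_reach (insert v S) (shift \<gamma> z1) (z + v)"
      using z(2) by (intro lit_reach.step lit_reach_mono[OF z(1)]) auto
    from lit_reach_trans[OF z1(1) this] have "lit_reach (insert v S) \<gamma> (z1 + (z + v))" .
    moreover have "x + z1 - v + z \<in> span S"
      using k one lit_reach_span[OF z(1)] by (intro span_add) auto
    then have "x + (z1 + (z + v)) \<in> span S"
      by (simp add: add_ac)
    ultimately show ?thesis using z(3) by (intro that) auto
  qed
qed

text \<open>Both ends are first made nonzero on \<open>S\<close>, the second one so that the joining
  witness falls into \<open>span S\<close>. There the transitivity of \<open>S\<close> applies, and
  the moves of \<open>z2\<close> are then retraced.\<close>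

lemma lit_transitive_insert: "lit_transitive (insert v S)"
  unfolding lit_transitive_def
proof (intro allI impI)
  fix \<alpha> x
  assume \<alpha>: "additive \<alpha>" and x: "x \<in> span (insert v S)" "linked \<alpha> x"
    and nz: "nonzero_on (insert v S) \<alpha>" "nonzero_on (insert v S) (shift \<alpha> x)"
  let ?S = "insert v S"
  have QS: "\<forall>s\<in>?S. Q s = 1" using Q_S Q_v' by auto
  obtain z1 where z1: "lit_reach ?S \<alpha> z1" "nonzero_on S (shift \<alpha> z1)"
    using reach_nonzero_on_old[OF nz(1)] by blast
  have "z1 + x \<in> span ?S" using lit_reach_span[OF z1(1)] x(1) by (rule span_add)
  then obtain z2 where z2: "lit_reach ?S (shift \<alpha> x) z2" "nonzero_on S (shift \<alpha> (x + z2))"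
      "z1 + x + z2 \<in> span S"
    using reach_old_coset[OF additive_shift[OF \<alpha>] nz(2)] by (metis shift_shift)
  have "linked \<alpha> (x + z2)"
    using linked_trans[OF \<alpha> x(2) lit_reach_linked[OF additive_shift[OF \<alpha>] QS z2(1)]] .
  moreover have "linked (shift \<alpha> z1) z1"
    using linked_sym[OF lit_reach_linked[OF \<alpha> QS z1(1)]] .
  ultimately have "linked (shift \<alpha> z1) (z1 + (x + z2))"
    using linked_trans[OF additive_shift[OF \<alpha>], of z1 z1 "x + z2"] by simp
  then have "lit_reach S (shift \<alpha> z1) (z1 + (x + z2))"
    using S additive_shift[OF \<alpha>] z1(2) z2(2,3) by (simp add: lit_transitive_def add.assoc)
  then have "lit_reach ?S \<alpha> (x + z2)"
    using lit_reach_trans[OF z1(1) lit_reach_mono] by (metis double_left subset_insertI)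
  moreover have "lit_reach ?S (shift \<alpha> (x + z2)) z2"
    using lit_reach_sym[OF z2(1)] by simp
  ultimately show "lit_reach ?S \<alpha> x"
    using lit_reach_trans by (fastforce simp: add.assoc)
qed

end

section \<open>Connected graphs containing E6\<close>

lemma lit_transitive_connected:
  assumes "finite S" and "E \<subseteq> S" and Q_S: "\<forall>s\<in>S. Q s = 1"
    and conn: "connected_graph S (form_adj \<omega>)"
  shows "lit_transitive S"
proof -
  \<comment> \<open>The induction on vertices takes the form of a maximal lit-transitive set. Being
    closed under neighbours in \<open>S\<close>, it contains everything connected to
    \<open>v1\<close>.\<close>
  define A where "A = {U. E \<subseteq> U \<and> U \<subseteq> S \<and> lit_transitive U}"
  have "finite A" using assms(1) unfolding A_def by auto
  moreover have "E \<in> A" using e6_lit_transitive assms(2) by (auto simp: A_def)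
  ultimately obtain U where "U \<in> A" and max: "\<And>U'. U' \<in> A \<Longrightarrow> U \<subseteq> U' \<Longrightarrow> U = U'"
    using finite_has_maximal[of A] by (metis empty_iff)
  then have U: "E \<subseteq> U" "U \<subseteq> S" "lit_transitive U" by (auto simp: A_def)
  have closed: "y \<in> U" if "x \<in> U" "y \<in> S" "form_adj \<omega> x y" for x y
  proof -
    have "lit_transitive (insert y U)"
      using U that Q_S by (intro lit_transitive_insert[of U x y]) (auto simp: form_adj_def)
    then have "insert y U \<in> A" using U that by (auto simp: A_def)
    then show ?thesis using max by blast
  qed
  have "w \<in> U" if "w \<in> S" for w
  proof -
    have "(\<lambda>x y. x \<in> S \<and> y \<in> S \<and> form_adj \<omega> x y)\<^sup>*\<^sup>* v1 w"
      using conn that assms(2) by (auto simp: connected_graph_def)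
    then show ?thesis
      by induction (use U closed in auto)
  qed
  with U have "U = S" by auto
  with U show ?thesis by auto
qed

end

lemma (in f2_quadratic_space) lit_transitive_tree:
  assumes "finite S" and Q_S: "\<forall>s\<in>S. Q s = 1"
    and tree: "is_tree S (form_adj \<omega>)"
    and "contains_induced S (form_adj \<omega>) E6_verts E6_adj"
  shows "lit_transitive S"
proof -
  from assms(4) obtain f where f: "f ` {1..6::nat} \<subseteq> S"
    and adj: "\<And>i j. i \<in> {1..6} \<Longrightarrow> j \<in> {1..6} \<Longrightarrow> \<omega> (f i) (f j) = 1 \<longleftrightarrow> E6_adj i j"
    unfolding contains_induced_def E6_verts_def form_adj_def by auto
  have form: "\<omega> (f i) (f j) = (if E6_adj i j then 1 else 0)" if "i \<in> {1..6}" "j \<in> {1..6}" for i j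
    using adj[OF that] by auto
  have f_S: "f i \<in> S" if "i \<in> {1..6}" for i using f that by blast
  have Q_f: "Q (f i) = 1" if "i \<in> {1..6}" for i using Q_S f_S[OF that] by blast
  interpret e6_configuration scale \<omega> Q "f 1" "f 2" "f 3" "f 4" "f 5" "f 6"
    by unfold_locales (simp_all add: form Q_f E6_adj_def doubleton_eq_iff)
  show ?thesis
    using assms tree f_S by (intro lit_transitive_connected) (auto simp: is_tree_def)
qed

section \<open>The orbit criterion\<close>

theorem theorem9p13:
  fixes scale :: "bit \<Rightarrow> 'a::ab_group_add \<Rightarrow> 'a"
    and \<omega> :: "'a \<Rightarrow> 'a \<Rightarrow> bit"
    and S :: "'a set"
    and \<alpha> \<beta> :: "'a \<Rightarrow> bit"
  assumes "\<exists>B. finite_dimensional_vector_space scale B"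
    and "alternating_form scale \<omega>"
    and "is_basis scale S"
    and "orthogonal_type scale \<omega> S"
    and "\<alpha> \<in> dual_space scale" and "\<alpha> \<noteq> (\<lambda>_. 0)"
    and "\<beta> \<in> dual_space scale" and "\<beta> \<noteq> (\<lambda>_. 0)"
  shows "(\<exists>Orb \<in> orbits (Gamma_dual scale \<omega> S) (dual_space scale) (\<lambda>h. h). \<alpha> \<in> Orb \<and> \<beta> \<in> Orb) \<longleftrightarrow>
         (\<exists>x. \<omega> x = (\<lambda>y. \<alpha> y + \<beta> y) \<and> basis_form scale \<omega> S x = \<alpha> x)"
proof -
  from assms(1) obtain B where "finite_dimensional_vector_space scale B" by blast
  then interpret V: finite_dimensional_vector_space scale B .
  \<comment> \<open>Finiteness gives the unique existence behind \<open>basis_form\<close> and the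
    maximal set in \<open>lit_transitive_connected\<close>.\<close>
  have finite_basis: "finite A" if "is_basis scale A" for A
    using that by (auto simp: is_basis_def intro: V.finiteI_independent)
  define Q where "Q = basis_form scale \<omega> S"
  have "(\<forall>s\<in>S. Q s = 1) \<and> (\<forall>x y. Q (x + y) + Q x + Q y = \<omega> x y)"
    unfolding Q_def basis_form_def
    using theI'[OF basis_form_unique_existence[OF V.vector_space_axioms assms(2,3)
      finite_basis[OF assms(3)]]]
    by blast
  then have Q: "\<forall>s\<in>S. Q s = 1" and polar: "\<And>x y. Q (x + y) + Q x + Q y = \<omega> x y"
    by auto
  interpret f2_quadratic_space scale \<omega> Q
  proof
    show "\<omega> (x + y) z = \<omega> x z + \<omega> y z" for x y z
      using assms(2) by (auto simp: alternating_form_def bilinear_form_def Vector_Spaces.linear_iff)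
    show "\<omega> x x = 0" for x
      using assms(2) by (simp add: alternating_form_def)
    show "\<omega> x y = \<omega> y x" for x y
      using polar[of x y] polar[of y x] by (simp add: add_ac)
    show "Q (x + y) = Q x + Q y + \<omega> x y" for x y
      unfolding polar[of x y, symmetric] by (simp add: add_ac)
  qed
  obtain S' where S': "is_basis scale S'" "t_equivalent \<omega> S S'" "is_tree S' (form_adj \<omega>)"
      "contains_induced S' (form_adj \<omega>) E6_verts E6_adj"
    using assms(4) by (auto simp: orthogonal_type_def)
  have \<alpha>: "additive \<alpha>" and \<beta>: "additive \<beta>"
    using assms(5,7) by (simp_all add: dual_space_iff)
  show ?thesis
    unfolding orbits_Gamma_dual_iff Q_def[symmetric]
  proof
    assume "\<exists>\<gamma>. additive \<gamma> \<and> (\<exists>g\<in>Gamma scale \<omega> S. \<alpha> = \<gamma> \<circ> g) \<and> (\<exists>h\<in>Gamma scale \<omega> S. \<beta> = \<gamma> \<circ> h)"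
    then obtain \<gamma> x y where \<gamma>: "additive \<gamma>" and x: "\<alpha> = shift \<gamma> x" "linked \<gamma> x"
      and y: "\<beta> = shift \<gamma> y" "linked \<gamma> y"
      using Gamma_linked[of S] Q by metis
    \<comment> \<open>The witness goes back along \<open>x\<close> from \<open>\<alpha>\<close> to
      \<open>\<gamma>\<close> and then along \<open>y\<close> to \<open>\<beta>\<close>.\<close>
    have "linked \<alpha> (x + y)"
      using linked_trans[OF \<alpha>, of x y] linked_sym[OF x(2)] y(2) unfolding x(1) by simp
    moreover have "\<omega> (x + y) = (\<lambda>z. \<alpha> z + \<beta> z)"
      by (auto simp: x(1) y(1) shift_def form_add_left add_ac)
    ultimately show "\<exists>x. \<omega> x = (\<lambda>y. \<alpha> y + \<beta> y) \<and> Q x = \<alpha> x"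
      by (auto simp: linked_def)
  next
    assume "\<exists>x. \<omega> x = (\<lambda>y. \<alpha> y + \<beta> y) \<and> Q x = \<alpha> x"
    then obtain x where form_x: "\<omega> x = (\<lambda>y. \<alpha> y + \<beta> y)" and "Q x = \<alpha> x" by blast
    then have x: "\<beta> = shift \<alpha> x" "linked \<alpha> x"
      by (auto simp: shift_def linked_def)
    \<comment> \<open>The game is played on \<open>S'\<close>, which generates the same group and on
      which \<open>Q\<close> is also constantly 1.\<close>
    have "lit_transitive S'"
      using S' finite_basis t_equivalent_invariants(2)[OF S'(2)] Q by (intro lit_transitive_tree) auto
    moreover have span: "V.span S' = UNIV" using S'(1) by (simp add: is_basis_def)
    ultimately have "lit_reach S' \<alpha> x"
      using \<alpha> \<beta> x assms(6,8) nonzero_on_spanning[OF span] by (simp add: lit_transitive_def)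
    then obtain g where "g \<in> Gamma scale \<omega> S'" "\<alpha> \<circ> g = \<beta>"
      using lit_reach_Gamma[OF _ \<alpha>] x(1) by blast
    then show "\<exists>\<gamma>. additive \<gamma> \<and> (\<exists>g\<in>Gamma scale \<omega> S. \<alpha> = \<gamma> \<circ> g) \<and> (\<exists>h\<in>Gamma scale \<omega> S. \<beta> = \<gamma> \<circ> h)"
      using \<alpha> id_in_Gamma[of S] t_equivalent_invariants(1)[OF S'(2)]
      by (intro exI[of _ \<alpha>]) (metis comp_id)
  qed
qed

end
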